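(* For any integers $k\ge 1$ and $m>1$, the polynomial $1+x^{2^{k-1}}$ divides $R_{2^km}(x)$ in $\mathbb{Z}[x]$, where $R_n(x)=\sum_{j=0}^{n-1} c_n(j)x^j$.
   Context: For integers $n\ge 1$ and $j$, the Ramanujan sum is $c_n(j)=\sum_{1\le i\le n,\ \gcd(i,n)=1} e^{2\pi i' ij/n}$ where $i'=\sqrt{-1}$; equivalently $c_n(j)$ is the sum of the $j$th powers of the primitive $n$th roots of unity. *)

theory Defs
  imports Complex_Main "HOL-Computational_Algebra.Polynomial"
begin

definition ramanujan_sum :: "nat \<Rightarrow> int \<Rightarrow> complex" where
  "ramanujan_sum n j =
     (\<Sum>i | i \<in> {1..n} \<and> gcd i n = 1. exp (2 * of_real pi * \<i> * of_nat i * of_int j / of_nat n))"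

definition ramanujan_poly :: "nat \<Rightarrow> complex poly" where
  "ramanujan_poly n = (\<Sum>j<n. monom (ramanujan_sum n (int j)) j)"

end

theory Submission
  imports Defs "HOL-Analysis.Complex_Transcendental"
begin

text \<open>
  Write \<open>N = 2^(k-1)\<close> and \<open>n = 2Nm\<close>. Modulo \<open>1 + x^N\<close> the monomial \<open>x^(aN+b)\<close> is \<open>(-1)^a x^b\<close>, so it
  suffices that the alternating sums of \<open>c_n(aN+b)\<close> over \<open>a < 2m\<close> vanish. Expanding \<open>c_n\<close>, each
  primitive \<open>n\<close>th root of unity \<open>z\<close> contributes \<open>z^b\<close> times a geometric sum with ratio \<open>-z^N\<close>; this
  ratio is a \<open>2m\<close>th root of unity, and it differs from \<open>1\<close> because \<open>z^N\<close> has order \<open>2m > 2\<close>.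
  That \<open>c_n\<close> is integer-valued follows by induction on \<open>n\<close> from
  \<open>\<Sum>d dvd n. c_d(j) = (if n dvd j then n else 0)\<close>.
\<close>

lemma exp_two_pi_i_rat_eq_1_iff:
  assumes "n > 0"
  shows "exp (2 * of_real pi * \<i> * of_int a / of_nat n) = (1 :: complex) \<longleftrightarrow> int n dvd a"
proof -
  have "exp (2 * of_real pi * \<i> * of_int a / of_nat n) = (1 :: complex) \<longleftrightarrow>
          (\<exists>q::int. 2 * pi * of_int a / of_nat n = of_int (2 * q) * pi)"
    unfolding exp_eq_1 by simp
  also have "\<dots> \<longleftrightarrow> (\<exists>q::int. real_of_int a = of_int (int n * q))"
    using assms by (simp add: field_simps)
  also have "\<dots> \<longleftrightarrow> int n dvd a"
    by (simp only: of_int_eq_iff dvd_def)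
  finally show ?thesis .
qed

lemma geometric_sum_root_of_unity:
  fixes z :: "'a :: field"
  assumes "z ^ n = 1"
  shows "(\<Sum>a<n. z ^ a) = (if z = 1 then of_nat n else 0)"
  using assms by (simp add: geometric_sum)

lemma sum_all_roots_of_unity:
  assumes "n > 0"
  shows "(\<Sum>i\<in>{1..n}. exp (2 * of_real pi * \<i> * of_nat i * of_int j / of_nat n)) =
           (if int n dvd j then of_nat n else 0 :: complex)"
proof -
  define w :: complex where "w = exp (2 * of_real pi * \<i> * of_int j / of_nat n)"
  have pow: "exp (2 * of_real pi * \<i> * of_nat i * of_int j / of_nat n) = w ^ i" for i
    unfolding w_def exp_of_nat_mult[symmetric] by (simp add: mult_ac)
  have "w ^ n = exp (2 * of_real pi * \<i> * of_int (int n * j) / of_nat n)"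
    unfolding w_def exp_of_nat_mult[symmetric] by (simp add: mult_ac)
  also have "\<dots> = 1"
    using exp_two_pi_i_rat_eq_1_iff[OF assms, of "int n * j"] by simp
  finally have wn: "w ^ n = 1" .
  \<comment> \<open>Shifting the range from \<open>{1..n}\<close> to \<open>{..<n}\<close> costs a
    factor \<open>w\<close>, harmless because the sum is nonzero only when
    \<open>w = 1\<close>.\<close>
  have "(\<Sum>i\<in>{1..n}. w ^ i) = w * (\<Sum>i<n. w ^ i)"
    by (simp add: sum_distrib_left sum.atLeast1_atMost_eq)
  also have "\<dots> = (if w = 1 then of_nat n else 0)"
    using geometric_sum_root_of_unity[OF wn] by simp
  also have "w = 1 \<longleftrightarrow> int n dvd j"
    unfolding w_def by (rule exp_two_pi_i_rat_eq_1_iff[OF assms])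
  finally show ?thesis
    by (simp only: pow)
qed

text \<open>Every \<open>n\<close>th root of unity is a primitive \<open>d\<close>th root for
  exactly one divisor \<open>d\<close> of \<open>n\<close>, so the left side adds up the
  \<open>j\<close>th powers of all \<open>n\<close>th roots of unity.\<close>

lemma sum_ramanujan_sum_divisors:
  assumes "n > 0"
  shows "(\<Sum>d | d dvd n. ramanujan_sum d j) = (if int n dvd j then of_nat n else 0)"
proof -
  let ?e = "\<lambda>d i::nat. exp (2 * of_real pi * \<i> * of_nat i * of_int j / of_nat d) :: complex"
  let ?P = "\<lambda>d. {i. i \<in> {1..d} \<and> gcd i d = 1}"
  have "(\<Sum>d | d dvd n. ramanujan_sum d j) = (\<Sum>(d, i)\<in>Sigma {d. d dvd n} ?P. ?e d i)"
    unfolding ramanujan_sum_def using assms by (subst sum.Sigma) auto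
  also have "\<dots> = (\<Sum>l\<in>{1..n}. ?e n l)"
  \<comment> \<open>The bijection writes the fraction \<open>l / n\<close> in lowest terms as
    \<open>i / d\<close>. Its inverse expands \<open>i / d\<close> by \<open>q = n div d\<close>,
    which is then the gcd to be cancelled.\<close>
  proof (rule sum.reindex_bij_witness[where
        i = "\<lambda>l. (n div gcd l n, l div gcd l n)" and j = "\<lambda>(d, i). i * (n div d)"])
    fix x assume "x \<in> Sigma {d. d dvd n} ?P"
    then obtain d i q where x: "x = (d, i)" and n: "n = d * q" and i: "1 \<le> i" "i \<le> d" "gcd i d = 1"
      by (auto elim!: dvdE)
    have pos: "d > 0" "q > 0"
      using assms n by auto
    have "gcd (i * q) (d * q) = q"
      using gcd_mult_distrib_nat[of q i d] i(3) by (simp add: mult.commute)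
    then show "(n div gcd (case x of (d, i) \<Rightarrow> i * (n div d)) n,
                (case x of (d, i) \<Rightarrow> i * (n div d)) div gcd (case x of (d, i) \<Rightarrow> i * (n div d)) n) = x"
      using pos by (simp add: x n)
    show "(case x of (d, i) \<Rightarrow> i * (n div d)) \<in> {1..n}"
      using pos i by (simp add: x n)
    show "?e n (case x of (d, i) \<Rightarrow> i * (n div d)) = (case x of (d, i) \<Rightarrow> ?e d i)"
      using pos by (simp add: x n mult.assoc)
  next
    fix l assume l: "l \<in> {1..n}"
    define g where "g = gcd l n"
    have g: "g dvd l" "g dvd n" "g > 0"
      using assms by (auto simp: g_def)
    have "coprime (l div g) (n div g)"
      unfolding g_def using assms by (intro div_gcd_coprime) auto
    then show "(n div gcd l n, l div gcd l n) \<in> Sigma {d. d dvd n} ?P"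
      using l g by (auto simp: g_def[symmetric] div_le_mono dvd_imp_le Suc_le_eq div_greater_zero_iff
          coprime_iff_gcd_eq_1)
    show "(case (n div gcd l n, l div gcd l n) of (d, i) \<Rightarrow> i * (n div d)) = l"
      using g assms by (auto simp: g_def[symmetric] elim!: dvdE)
  qed
  also have "\<dots> = (if int n dvd j then of_nat n else 0)"
    by (rule sum_all_roots_of_unity[OF assms])
  finally show ?thesis .
qed

lemma ramanujan_sum_in_Ints: "ramanujan_sum n j \<in> \<int>"
proof (induction n rule: less_induct)
  case (less n)
  show ?case
  \<comment> \<open>The divisor identity requires \<open>n > 0\<close>; for \<open>n = 0\<close> the
    sum defining \<open>ramanujan_sum\<close> is empty.\<close>
  proof (cases "n = 0")
    case True
    then show ?thesis by (simp add: ramanujan_sum_def)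
  next
    case False
    have fin: "finite {d. d dvd n}"
      using False by simp
    \<comment> \<open>The divisor identity is solved for its term \<open>d = n\<close>; only smaller
      divisors remain.\<close>
    have "ramanujan_sum n j =
            (if int n dvd j then of_nat n else 0) - (\<Sum>d\<in>{d. d dvd n} - {n}. ramanujan_sum d j)"
      using sum_ramanujan_sum_divisors[of n j] False sum.remove[OF fin, of n "\<lambda>d. ramanujan_sum d j"]
      by (simp only: eq_diff_eq mem_Collect_eq dvd_refl)
    moreover have "(\<Sum>d\<in>{d. d dvd n} - {n}. ramanujan_sum d j) \<in> \<int>"
      using False by (intro Ints_sum less.IH) (auto dest!: dvd_imp_le)
    ultimately show ?thesis by simp
  qed
qed

lemma alternating_sum_ramanujan_sum:
  assumes "N > 0" and "m > 1"
  shows "(\<Sum>a<2*m. (-1) ^ a * ramanujan_sum (2 * N * m) (int (a * N + b))) = 0"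
proof -
  let ?n = "2 * N * m"
  have n: "?n > 0"
    using assms by simp
  let ?e = "\<lambda>i j. exp (2 * of_real pi * \<i> * of_nat i * of_int (int j) / of_nat ?n) :: complex"
  have inner: "(\<Sum>a<2*m. (-1) ^ a * ?e i (a * N + b)) = 0" if "gcd i ?n = 1" for i
  proof -
    define r where "r = - ?e i N"
    have e_eq_1: "?e i j = 1 \<longleftrightarrow> ?n dvd i * j" for j
      using exp_two_pi_i_rat_eq_1_iff[OF n, of "int (i * j)"]
      by (simp only: int_dvd_int_iff) (simp add: mult_ac)
    have e_pow: "?e i j ^ a = ?e i (a * j)" for j a
      unfolding exp_of_nat_mult[symmetric] by (simp add: mult_ac)
    have e_add: "?e i (j + l) = ?e i j * ?e i l" for j l
      unfolding exp_add[symmetric] by (simp add: ring_distribs add_divide_distrib)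
    \<comment> \<open>The sign in \<open>r\<close> disappears because the exponent is even.\<close>
    have "r ^ (2 * m) = ?e i (2 * m * N)"
      unfolding r_def by (simp only: e_pow power_minus_even even_mult_iff even_numeral simp_thms)
    also have "\<dots> = 1"
      unfolding e_eq_1 by (simp add: mult_ac)
    finally have "r ^ (2 * m) = 1" .
    \<comment> \<open>If \<open>r = 1\<close>, squaring \<open>?e i N = -1\<close> gives
      \<open>?n dvd i * (2 * N)\<close>. As \<open>i\<close> is coprime to \<open>?n\<close>, this
      forces \<open>2 * N * m\<close> to divide \<open>2 * N\<close>, against
      \<open>m > 1\<close>.\<close>
    moreover have "r \<noteq> 1"
    proof
      assume "r = 1"
      then have "?e i N = -1"
        unfolding r_def by (metis minus_minus)
      then have "?e i N ^ 2 = 1"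
        by (simp only: power_minus_even even_numeral power_one)
      then have "?n dvd i * (2 * N)"
        by (simp only: e_pow e_eq_1)
      moreover have "coprime ?n i"
        using that by (simp add: coprime_iff_gcd_eq_1 gcd.commute)
      ultimately have "?n dvd 2 * N"
        by (simp only: coprime_dvd_mult_right_iff)
      then show False
        using assms by (auto dest: dvd_imp_le)
    qed
    ultimately have "(\<Sum>a<2*m. r ^ a) = 0"
      by (simp add: geometric_sum_root_of_unity)
    moreover have "(-1) ^ a * ?e i (a * N + b) = ?e i b * r ^ a" for a
      unfolding r_def e_add e_pow[symmetric] by (subst power_minus) (simp only: mult_ac)
    ultimately show ?thesis
      by (simp only: sum_distrib_left[symmetric] mult_zero_right)
  qed
  have "(\<Sum>a<2*m. (-1) ^ a * ramanujan_sum ?n (int (a * N + b))) =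
          (\<Sum>i | i \<in> {1..?n} \<and> gcd i ?n = 1. \<Sum>a<2*m. (-1) ^ a * ?e i (a * N + b))"
    unfolding ramanujan_sum_def sum_distrib_left by (rule sum.swap)
  also have "\<dots> = 0"
    by (intro sum.neutral ballI inner) simp
  finally show ?thesis .
qed

text \<open>This is reduction modulo \<open>1 + x^N\<close>, kept generic in the coefficient ring so
  that it applies to integer polynomials directly.\<close>

lemma one_plus_monom_dvd_sum_monom:
  fixes C :: "nat \<Rightarrow> 'a :: comm_ring_1"
  assumes "\<And>b. b < N \<Longrightarrow> (\<Sum>a<M. (-1) ^ a * C (a * N + b)) = 0"
  shows "1 + monom 1 N dvd (\<Sum>j<M * N. monom (C j) j)"
proof -
  have diff: "1 + monom 1 N dvd monom 1 (a * N) - (monom ((-1) ^ a) 0 :: 'a poly)" for a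
  proof -
    \<comment> \<open>An instance of \<open>x - y\<close> dividing \<open>x^a - y^a\<close>, with
      \<open>y = -1\<close>.\<close>
    have "monom 1 N - (- 1) dvd monom 1 N ^ a - (- 1 :: 'a poly) ^ a"
      unfolding power_diff_sumr2 by simp
    moreover have "(monom ((-1) ^ a) 0 :: 'a poly) = (- 1) ^ a"
      by (cases "even a") (simp_all add: monom_0, simp add: one_pCons)
    ultimately show ?thesis
      by (simp add: monom_power mult.commute add.commute)
  qed
  have split: "monom (C (a * N + b)) (a * N + b) =
        monom (C (a * N + b)) b * (monom 1 (a * N) - monom ((-1) ^ a) 0)
        + monom ((-1) ^ a * C (a * N + b)) b" for a b
    by (simp add: ring_distribs mult_monom add.commute mult.commute)
  have "(\<Sum>j<M * N. monom (C j) j) = (\<Sum>a<M. \<Sum>b<N. monom (C (a * N + b)) (a * N + b))"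
    unfolding sum.nat_group[symmetric]
    using sum.shift_bounds_nat_ivl[of "\<lambda>j. monom (C j) j" 0 "_ * N" N]
    by (simp add: atLeast0LessThan add.commute)
  \<comment> \<open>Each term of the first double sum is divisible by \<open>diff\<close>. The
    second is swapped so that its inner sum, over \<open>a\<close>, is the one the hypothesis
    kills.\<close>
  also have "\<dots> = (\<Sum>a<M. \<Sum>b<N. monom (C (a * N + b)) b * (monom 1 (a * N) - monom ((-1) ^ a) 0))
                 + (\<Sum>b<N. \<Sum>a<M. monom ((-1) ^ a * C (a * N + b)) b)"
    by (subst split, unfold sum.distrib) (subst (2) sum.swap, rule refl)
  also have "(\<Sum>b<N. \<Sum>a<M. monom ((-1) ^ a * C (a * N + b)) b) = 0"
    using assms by (simp add: monom_sum[symmetric])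
  finally show ?thesis
    by (simp add: dvd_sum diff)
qed

theorem theorem8:
  fixes k m :: nat
  assumes "k \<ge> 1" and "m > 1"
  shows "\<exists>R :: int poly. map_poly of_int R = ramanujan_poly (2 ^ k * m) \<and>
           1 + monom 1 (2 ^ (k - 1)) dvd R"
proof -
  define N :: nat where "N = 2 ^ (k - 1)"
  have n: "2 ^ k * m = 2 * N * m"
    using assms(1) by (cases k) (simp_all add: N_def)
  have "\<forall>j. \<exists>c. ramanujan_sum (2 * N * m) (int j) = of_int c"
    using ramanujan_sum_in_Ints by (blast elim: Ints_cases)
  then obtain C where C: "ramanujan_sum (2 * N * m) (int j) = of_int (C j)" for j
    by (auto dest: choice)
  define R :: "int poly" where "R = (\<Sum>j<2 * N * m. monom (C j) j)"
  have "map_poly of_int R = ramanujan_poly (2 ^ k * m)"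
    unfolding n ramanujan_poly_def R_def
    by (intro poly_eqI) (simp add: coeff_map_poly coeff_sum C if_distrib cong: if_cong)
  moreover have "1 + monom 1 N dvd R"
    \<comment> \<open>The rewriting turns the bound \<open>2 * N * m\<close> into
      \<open>2 * m * N\<close>, that is, \<open>2 * m\<close> blocks of length
      \<open>N\<close>.\<close>
    unfolding R_def mult.assoc[of 2 N m] mult.left_commute[of 2 N m] mult.commute[of N "2 * m"]
  proof (rule one_plus_monom_dvd_sum_monom)
    fix b
    \<comment> \<open>The alternating sum is known to vanish over the complex numbers; injectivity
      of \<open>of_int\<close> brings this back to the integers.\<close>
    have "of_int (\<Sum>a<2*m. (-1) ^ a * C (a * N + b)) = (0 :: complex)"
      using alternating_sum_ramanujan_sum[of N m b] assms(2) unfolding C by (simp add: N_def)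
    then show "(\<Sum>a<2*m. (-1) ^ a * C (a * N + b)) = 0"
      by (simp only: of_int_eq_0_iff)
  qed
  ultimately show ?thesis
    unfolding N_def by blast
qed

end
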